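(* For any $k \geq 5$ and $n \geq 1$, $$sat(K_k^n, C_4) = \left\lfloor \frac{3(k-1)n -2}{2} \right\rfloor,$$ which equals $\frac{3}{2}(k-1)n - \frac{3}{2}$ if $k$ is even and $n$ is odd, and equals $\frac{3}{2}(k-1)n - 1$ otherwise. Moreover, for every $n\ge 1$, $\lfloor \frac{9}{2}n-1 \rfloor \leq sat(K_4^n, C_4) \leq 5n-1$.
   Context: All graphs are finite, simple and undirected. $K_k^n$ denotes the complete $k$-partite graph with exactly $n$ vertices in each of its $k$ parts. $C_4$ is the cycle on $4$ vertices. For graphs $G$ and $F$, a spanning subgraph $H$ of $G$ is $F$-saturated relative to $G$ if $H$ contains no copy of $F$ but $H+e$ contains a copy of $F$ for every $e\in E(G)\setminus E(H)$; $sat(G,F)$ is the minimum number of edges of a graph that is $F$-saturated relative to $G$. *)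

theory Defs
  imports Complex_Main
begin

text \<open>A graph is a pair of a vertex set and an edge set; edges of a simple undirected graph are
  two-element sets of vertices.\<close>

type_synonym 'a graph = "'a set \<times> 'a set set"

abbreviation verts :: "'a graph \<Rightarrow> 'a set" where
  "verts G \<equiv> fst G"

abbreviation edges :: "'a graph \<Rightarrow> 'a set set" where
  "edges G \<equiv> snd G"

definition simple_graph :: "'a graph \<Rightarrow> bool" where
  "simple_graph G \<longleftrightarrow> finite (verts G) \<and> (\<forall>e\<in>edges G. e \<subseteq> verts G \<and> card e = 2)"

definition add_edge :: "'a graph \<Rightarrow> 'a set \<Rightarrow> 'a graph" where
  "add_edge H e = (verts H, insert e (edges H))"

definition spanning_subgraph :: "'a graph \<Rightarrow> 'a graph \<Rightarrow> bool" where
  "spanning_subgraph H G \<longleftrightarrow> simple_graph H \<and> verts H = verts G \<and> edges H \<subseteq> edges G"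

text \<open>A copy of \<open>F\<close> in \<open>H\<close> is a subgraph of \<open>H\<close>, not necessarily induced, isomorphic to \<open>F\<close>.\<close>

definition contains_copy :: "'a graph \<Rightarrow> 'b graph \<Rightarrow> bool" where
  "contains_copy H F \<longleftrightarrow>
     (\<exists>f. inj_on f (verts F) \<and> f ` verts F \<subseteq> verts H \<and> (\<forall>e\<in>edges F. f ` e \<in> edges H))"

definition saturated_in :: "'b graph \<Rightarrow> 'a graph \<Rightarrow> 'a graph \<Rightarrow> bool" where
  "saturated_in F G H \<longleftrightarrow>
     spanning_subgraph H G \<and> \<not> contains_copy H F \<and>
     (\<forall>e\<in>edges G - edges H. contains_copy (add_edge H e) F)"

definition sat :: "'a graph \<Rightarrow> 'b graph \<Rightarrow> nat" where
  "sat G F = (LEAST m. \<exists>H. saturated_in F G H \<and> card (edges H) = m)"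

text \<open>The vertex \<open>(i, j)\<close> is the \<open>j\<close>-th vertex of the \<open>i\<close>-th part.\<close>

definition complete_multipartite :: "nat \<Rightarrow> nat \<Rightarrow> (nat \<times> nat) graph" where
  "complete_multipartite k n =
     ({..<k} \<times> {..<n},
      {{u, v} | u v. u \<in> {..<k} \<times> {..<n} \<and> v \<in> {..<k} \<times> {..<n} \<and> fst u \<noteq> fst v})"

definition C4 :: "nat graph" where
  "C4 = ({0, 1, 2, 3}, {{0, 1}, {1, 2}, {2, 3}, {3, 0}})"

lemma simple_graph_complete_multipartite: "simple_graph (complete_multipartite k n)"
  by (auto simp: simple_graph_def complete_multipartite_def card_2_iff)

lemma simple_graph_C4: "simple_graph C4"
  by (auto simp: simple_graph_def C4_def)

text \<open>The minimum defining \<^const>\<open>sat\<close> ranges over a nonempty set.\<close>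

lemma ex_saturated_in:
  assumes G: "simple_graph G" and F: "edges F \<noteq> {}"
  shows "\<exists>H. saturated_in F G H"
proof -
  define P where "P E \<longleftrightarrow> E \<subseteq> edges G \<and> \<not> contains_copy (verts G, E) F" for E
  have "edges G \<subseteq> Pow (verts G)" using G by (auto simp: simple_graph_def)
  then have fin: "finite (edges G)"
    using G by (meson finite_Pow_iff finite_subset simple_graph_def)
  have P0: "P {}" using F by (auto simp: P_def contains_copy_def)
  have "\<exists>E\<in>{E. P E}. \<forall>E'\<in>{E. P E}. E \<subseteq> E' \<longrightarrow> E = E'"
    by (rule finite_has_maximal) (use fin P0 in \<open>auto simp: P_def\<close>)
  then obtain E where E: "P E" and max: "\<And>E'. P E' \<Longrightarrow> E \<subseteq> E' \<Longrightarrow> E = E'" by blast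
  have "contains_copy (verts G, insert e E) F" if "e \<in> edges G - E" for e
  proof (rule ccontr)
    assume "\<not> ?thesis"
    with E that have "P (insert e E)" by (auto simp: P_def)
    with max that show False by blast
  qed
  with E G have "saturated_in F G (verts G, E)"
    by (auto simp: saturated_in_def spanning_subgraph_def P_def simple_graph_def add_edge_def)
  then show ?thesis ..
qed

end

theory Submission
  imports Defs
begin

text \<open>Lower bound: a saturated graph satisfies \<open>2 * e \<ge> 3 * (k - 1) * n - 3\<close>. Fix a vertex \<open>x\<close> of
  minimum degree; the claim is clear if this degree is at least 3. Otherwise every vertex outside
  the part of \<open>x\<close> is the end of a walk of length three from \<open>x\<close>, which starts with one of at most two
  edges, so almost all vertices lie in or next to a small neighbourhood \<open>A\<close>, and edges can be
  counted around \<open>A\<close>. What is lost against average degree 3 comes from vertices in at most three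
  parts.

  Upper bound: take a triangle with vertices in distinct parts and attach leaves and pendant
  triangles to its vertices, such that the leaves at any one vertex lie in the same part. Every
  leaf saves half an edge, and three parts (almost) can be used for leaves; the remaining vertices
  are paired across parts into pendant triangles.\<close>

section \<open>Saturation for the four-cycle\<close>

text \<open>Adjacent vertices of a simple graph differ, so distinctness of the two opposite pairs is
  all that injectivity of the embedding still requires.\<close>

lemma contains_copy_C4:
  assumes "simple_graph H"
  shows "contains_copy H C4 \<longleftrightarrow>
    (\<exists>a b c d. {a, b} \<in> edges H \<and> {b, c} \<in> edges H \<and> {c, d} \<in> edges H \<and> {d, a} \<in> edges H \<and>
       a \<noteq> c \<and> b \<noteq> d)"
proof
  assume "contains_copy H C4"
  then obtain f where f: "inj_on f {0, 1, 2, 3 :: nat}"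
      "\<forall>e\<in>edges C4. f ` e \<in> edges H"
    by (auto simp: contains_copy_def C4_def)
  have "f 0 \<noteq> f 2" "f 1 \<noteq> f 3" using f(1) by (auto simp: inj_on_def)
  moreover have "{f 0, f 1} \<in> edges H" "{f 1, f 2} \<in> edges H"
      "{f 2, f 3} \<in> edges H" "{f 3, f 0} \<in> edges H"
    using f(2) by (auto simp: C4_def)
  ultimately show "\<exists>a b c d. {a, b} \<in> edges H \<and> {b, c} \<in> edges H \<and> {c, d} \<in> edges H \<and>
       {d, a} \<in> edges H \<and> a \<noteq> c \<and> b \<noteq> d" by blast
next
  assume "\<exists>a b c d. {a, b} \<in> edges H \<and> {b, c} \<in> edges H \<and> {c, d} \<in> edges H \<and>
       {d, a} \<in> edges H \<and> a \<noteq> c \<and> b \<noteq> d"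
  then obtain a b c d where e: "{a, b} \<in> edges H" "{b, c} \<in> edges H" "{c, d} \<in> edges H"
      "{d, a} \<in> edges H" and ne: "a \<noteq> c" "b \<noteq> d" by blast
  have E: "u \<in> verts H \<and> v \<in> verts H \<and> u \<noteq> v" if "{u, v} \<in> edges H" for u v
    using assms that by (force simp: simple_graph_def)
  define f where "f i = (if i = 0 then a else if i = 1 then b else if i = 2 then c else d)"
    for i :: nat
  have "inj_on f {0, 1, 2, 3}" "f ` {0, 1, 2, 3} \<subseteq> verts H"
    using E[OF e(1)] E[OF e(2)] E[OF e(3)] E[OF e(4)] ne by (auto simp: f_def inj_on_def)
  moreover have "\<forall>e\<in>edges C4. f ` e \<in> edges H" using e by (auto simp: C4_def f_def insert_commute)
  ultimately show "contains_copy H C4"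
    unfolding contains_copy_def by (intro exI[of _ f]) (auto simp: C4_def)
qed

text \<open>Between nonadjacent distinct vertices a walk of length three is a path.\<close>

lemma saturated_in_C4_iff:
  assumes G: "simple_graph G" and E: "E \<subseteq> edges G"
  shows "saturated_in C4 G (verts G, E) \<longleftrightarrow>
    (\<forall>a b c d. {a, b} \<in> E \<longrightarrow> {b, c} \<in> E \<longrightarrow> {c, d} \<in> E \<longrightarrow> {d, a} \<in> E \<longrightarrow> a \<noteq> c \<longrightarrow> b = d) \<and>
    (\<forall>u v. {u, v} \<in> edges G - E \<longrightarrow> (\<exists>a b. {u, a} \<in> E \<and> {a, b} \<in> E \<and> {b, v} \<in> E))"
    (is "_ \<longleftrightarrow> ?free \<and> ?walk")
proof -
  have simple: "simple_graph (verts G, F)" if "F \<subseteq> edges G" for F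
    using G that by (auto simp: simple_graph_def)
  have free: "\<not> contains_copy (verts G, E) C4 \<longleftrightarrow> ?free"
    using contains_copy_C4[OF simple[OF E]] by auto
  have "contains_copy (add_edge (verts G, E) {u, v}) C4 \<longleftrightarrow>
      (\<exists>a b. {u, a} \<in> E \<and> {a, b} \<in> E \<and> {b, v} \<in> E)"
    if fr: ?free and uv: "{u, v} \<in> edges G - E" for u v
  proof
    have ne: "u \<noteq> v" using G uv by (auto simp: simple_graph_def)
    have simple': "simple_graph (verts G, insert {u, v} E)" using E uv by (intro simple) auto
    then have loop: "{w, w} \<notin> insert {u, v} E" for w by (force simp: simple_graph_def)
    assume "contains_copy (add_edge (verts G, E) {u, v}) C4"
    then obtain a b c d where e: "{a, b} \<in> insert {u, v} E" "{b, c} \<in> insert {u, v} E"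
        "{c, d} \<in> insert {u, v} E" "{d, a} \<in> insert {u, v} E" and ac: "a \<noteq> c" and bd: "b \<noteq> d"
      using contains_copy_C4[OF simple'] by (auto simp: add_edge_def)
    have d4: "a \<noteq> b" "b \<noteq> c" "c \<noteq> d" "d \<noteq> a" using e loop by metis+
    \<comment> \<open>By rotation the new edge may be taken as the first edge \<open>{p, q}\<close>
      of the cycle. The other three sides differ from it, hence are old, and form the required
      walk.\<close>
    have new: "\<exists>a b. {u, a} \<in> E \<and> {a, b} \<in> E \<and> {b, v} \<in> E"
      if "{p, q} = {u, v}" "{q, r} \<in> insert {u, v} E" "{r, s} \<in> insert {u, v} E"
        "{s, p} \<in> insert {u, v} E" "p \<noteq> r" "q \<noteq> s" "p \<noteq> q" "q \<noteq> r" "r \<noteq> s" "s \<noteq> p" for p q r s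
    proof -
      have E: "{q, r} \<in> E" "{r, s} \<in> E" "{s, p} \<in> E" using that by (auto simp: doubleton_eq_iff)
      then have "{r, q} \<in> E" "{s, r} \<in> E" "{p, s} \<in> E" by (simp_all add: insert_commute)
      moreover have "p = u \<and> q = v \<or> p = v \<and> q = u" using that(1) by (auto simp: doubleton_eq_iff)
      ultimately show ?thesis using E by blast
    qed
    consider "{a, b} = {u, v}" | "{b, c} = {u, v}" | "{c, d} = {u, v}" | "{d, a} = {u, v}"
    proof -
      have "\<not> ({a, b} \<in> E \<and> {b, c} \<in> E \<and> {c, d} \<in> E \<and> {d, a} \<in> E)"
        using fr[rule_format, of a b c d] ac bd by auto
      then show ?thesis using e that by auto
    qed
    then show "\<exists>a b. {u, a} \<in> E \<and> {a, b} \<in> E \<and> {b, v} \<in> E"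
    proof cases
      case 1 show ?thesis by (rule new[OF 1 e(2,3,4) ac bd d4])
    next
      case 2 show ?thesis by (rule new[OF 2 e(3,4,1) bd ac[symmetric] d4(2,3,4,1)])
    next
      case 3 show ?thesis by (rule new[OF 3 e(4,1,2) ac[symmetric] bd[symmetric] d4(3,4,1,2)])
    next
      case 4 show ?thesis by (rule new[OF 4 e(1,2,3) bd[symmetric] ac d4(4,1,2,3)])
    qed
  next
    assume "\<exists>a b. {u, a} \<in> E \<and> {a, b} \<in> E \<and> {b, v} \<in> E"
    then obtain a b where ab: "{u, a} \<in> E" "{a, b} \<in> E" "{b, v} \<in> E" by blast
    have "simple_graph (verts G, insert {u, v} E)" using E uv by (intro simple) auto
    moreover have "u \<noteq> b" "a \<noteq> v" using ab uv by auto
    ultimately show "contains_copy (add_edge (verts G, E) {u, v}) C4"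
      using ab unfolding add_edge_def
      by (subst contains_copy_C4, simp)
        (rule exI[of _ u], rule exI[of _ a], rule exI[of _ b], rule exI[of _ v], auto)
  qed
  then have closed: "contains_copy (add_edge (verts G, E) {u, v}) C4 \<longleftrightarrow>
      (\<exists>a b. {u, a} \<in> E \<and> {a, b} \<in> E \<and> {b, v} \<in> E)"
    if ?free "{u, v} \<in> edges G - E" for u v using that by blast
  have pair: "\<exists>u v. e = {u, v}" if "e \<in> edges G" for e
    using G that by (metis card_2_iff simple_graph_def)
  have "(\<forall>e\<in>edges G - E. contains_copy (add_edge (verts G, E) e) C4) \<longleftrightarrow> ?walk" if ?free
  proof
    assume all: "\<forall>e\<in>edges G - E. contains_copy (add_edge (verts G, E) e) C4"
    show ?walk
    proof (intro allI impI)
      fix u v assume "{u, v} \<in> edges G - E"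
      with all closed[OF that this] show "\<exists>a b. {u, a} \<in> E \<and> {a, b} \<in> E \<and> {b, v} \<in> E" by blast
    qed
  next
    assume walk: ?walk
    show "\<forall>e\<in>edges G - E. contains_copy (add_edge (verts G, E) e) C4"
    proof
      fix e assume e: "e \<in> edges G - E"
      then obtain u v where uv: "e = {u, v}" using pair by blast
      show "contains_copy (add_edge (verts G, E) e) C4"
        using walk closed[OF that, of u v] e unfolding uv by blast
    qed
  qed
  then show ?thesis
    using simple[OF E] E free by (auto simp: saturated_in_def spanning_subgraph_def)
qed

text \<open>Handshake by double counting: the neighbours \<open>w\<close> of \<open>v\<close>
  correspond to the edges \<open>{v, w}\<close> at \<open>v\<close>, and every edge has two
  ends.\<close>

lemma simple_graph_sum_degree:
  assumes "finite V" and E: "\<And>e. e \<in> E \<Longrightarrow> e \<subseteq> V \<and> card e = 2"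
  shows "(\<Sum>v\<in>V. card {w. {v, w} \<in> E}) = 2 * card E"
proof -
  have fin: "finite E" using assms by (meson Pow_iff finite_Pow_iff finite_subset subsetI)
  have "card {w. {v, w} \<in> E} = card {e\<in>E. v \<in> e}" for v
  proof (rule bij_betw_same_card)
    show "bij_betw (\<lambda>w. {v, w}) {w. {v, w} \<in> E} {e\<in>E. v \<in> e}"
      unfolding bij_betw_def
    proof
      show "inj_on (\<lambda>w. {v, w}) {w. {v, w} \<in> E}" by (auto simp: inj_on_def doubleton_eq_iff)
      have "\<exists>w. e = {v, w}" if "e \<in> E" "v \<in> e" for e
        using E[OF that(1)] that(2) by (auto simp: card_2_iff)
      then show "(\<lambda>w. {v, w}) ` {w. {v, w} \<in> E} = {e\<in>E. v \<in> e}" by blast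
    qed
  qed
  then have "(\<Sum>v\<in>V. card {w. {v, w} \<in> E}) = (\<Sum>v\<in>V. card {e\<in>E. v \<in> e})" by simp
  also have "\<dots> = 2 * card E"
    by (rule sum_multicount) (use assms fin in \<open>auto simp: Collect_conj_eq Int_absorb1 subset_iff[symmetric]\<close>)
  finally show ?thesis .
qed

section \<open>The lower bound\<close>

text \<open>Since all counting is by degrees, the graph is given by its neighbourhoods. By
  \<open>N_subset\<close> and \<open>N_sym\<close> these are empty outside \<open>V\<close>. The
  axiom \<open>other_part\<close> provides every vertex with the target of a walk, so there are no
  isolated vertices.\<close>

locale C4_saturated =
  fixes V :: "'a set" and N :: "'a \<Rightarrow> 'a set" and p :: "'a \<Rightarrow> 'b" and n :: nat
  assumes finite_V: "finite V"
    and N_subset: "N v \<subseteq> V"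
    and N_sym: "w \<in> N v \<Longrightarrow> v \<in> N w"
    and N_part: "w \<in> N v \<Longrightarrow> p w \<noteq> p v"
    and C4_free: "\<lbrakk>b \<in> N a; b \<in> N c; d \<in> N a; d \<in> N c; a \<noteq> c\<rbrakk> \<Longrightarrow> b = d"
    and walk: "\<lbrakk>u \<in> V; v \<in> V; p u \<noteq> p v; v \<notin> N u\<rbrakk> \<Longrightarrow> \<exists>a b. a \<in> N u \<and> b \<in> N a \<and> v \<in> N b"
    and card_part: "card {v\<in>V. p v = i} \<le> n"
    and other_part: "u \<in> V \<Longrightarrow> \<exists>v\<in>V. p v \<noteq> p u"
begin

lemma finite_N [simp]: "finite (N v)"
  using finite_V N_subset finite_subset by blast

lemma not_in_N [simp]: "v \<notin> N v"
  using N_part by blast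

lemma N_in_V: "w \<in> N v \<Longrightarrow> w \<in> V" "w \<in> N v \<Longrightarrow> v \<in> V"
  using N_subset N_sym by blast+

lemma card_N_pos: "v \<in> V \<Longrightarrow> card (N v) \<ge> 1"
proof -
  assume v: "v \<in> V"
  then obtain w where "w \<in> V" "p w \<noteq> p v" using other_part by blast
  then have "N v \<noteq> {}" using walk[of v w] v by force
  then show ?thesis by (simp add: Suc_leI card_gt_0_iff)
qed

lemma card_le_parts:
  assumes "W \<subseteq> V" "card (p ` W) \<le> m"
  shows "card W \<le> m * n"
proof -
  have fin: "finite W" using assms(1) finite_V finite_subset by blast
  have "card W = (\<Sum>i\<in>p ` W. card {v\<in>W. p v = i})"
    using sum.image_gen[OF fin, of "\<lambda>_. 1::nat" p] by simp
  also have "\<dots> \<le> (\<Sum>i\<in>p ` W. n)"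
  proof (rule sum_mono)
    fix i
    have "card {v\<in>W. p v = i} \<le> card {v\<in>V. p v = i}"
      by (rule card_mono) (use assms(1) finite_V in auto)
    then show "card {v\<in>W. p v = i} \<le> n" using card_part[of i] by linarith
  qed
  also have "\<dots> \<le> m * n" using assms(2) by simp
  finally show ?thesis .
qed

lemma card_le_one_part:
  assumes "W \<subseteq> V" "\<And>v w. v \<in> W \<Longrightarrow> w \<in> W \<Longrightarrow> p v = p w"
  shows "card W \<le> n"
proof -
  have "finite (p ` W)" using assms(1) finite_V finite_subset by blast
  then have "card (p ` W) \<le> 1" unfolding One_nat_def by (subst card_le_Suc0_iff_eq) (use assms(2) in blast)+
  then show ?thesis using card_le_parts[OF assms(1), of 1] by simp
qed

section \<open>Double counting of degrees around a small centre\<close>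

lemma sum_card_N_Int_swap:
  assumes "finite A" "finite D"
  shows "(\<Sum>a\<in>A. card (N a \<inter> D)) = (\<Sum>d\<in>D. card (N d \<inter> A))"
proof -
  have "(\<Sum>a\<in>A. card {d\<in>D. d \<in> N a}) = (\<Sum>d\<in>D. card {a\<in>A. d \<in> N a})"
    by (rule sum_multicount_gen) (use assms in auto)
  moreover have "{d\<in>D. d \<in> N a} = N a \<inter> D" "{a\<in>A. d \<in> N a} = N d \<inter> A" for a d
    using N_sym by auto
  ultimately show ?thesis by simp
qed

text \<open>\<open>X\<close> is a small centre, \<open>A\<close> its neighbourhood, \<open>D\<close> the vertices next to \<open>A\<close>, and \<open>Q\<close> the rest.\<close>

lemma sum_degree_ge:
  assumes V: "V = X \<union> A \<union> D \<union> Q"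
    and disj: "X \<inter> A = {}" "X \<inter> D = {}" "X \<inter> Q = {}" "A \<inter> D = {}" "A \<inter> Q = {}" "D \<inter> Q = {}"
    and X: "\<And>a. a \<in> A \<Longrightarrow> \<exists>x\<in>X. x \<in> N a"
  shows "(\<Sum>v\<in>X. card (N v)) + card A + (\<Sum>a\<in>A. card (N a \<inter> A)) + (\<Sum>d\<in>D. card (N d \<inter> A))
    + (\<Sum>d\<in>D. card (N d)) + (\<Sum>q\<in>Q. card (N q)) \<le> (\<Sum>v\<in>V. card (N v))"
proof -
  have fin: "finite X" "finite A" "finite D" "finite Q" using V finite_V by auto
  \<comment> \<open>Edges from \<open>a\<close> into \<open>X\<close>, \<open>A\<close> and
    \<open>D\<close> are disjoint. Those between \<open>A\<close> and \<open>D\<close> are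
    afterwards counted from \<open>D\<close>, so that each \<open>d \<in> D\<close> is credited with
    them on top of its own degree.\<close>
  have "1 + card (N a \<inter> A) + card (N a \<inter> D) \<le> card (N a)" if a: "a \<in> A" for a
  proof -
    obtain x where x: "x \<in> X" "x \<in> N a" using X[OF a] by blast
    have "card ({x} \<union> (N a \<inter> A) \<union> (N a \<inter> D)) = 1 + card (N a \<inter> A) + card (N a \<inter> D)"
    proof -
      have "x \<notin> (N a \<inter> A) \<union> (N a \<inter> D)" "(N a \<inter> A) \<inter> (N a \<inter> D) = {}" using x disj by auto
      then show ?thesis by (simp add: card_Un_disjoint)
    qed
    moreover have "card ({x} \<union> (N a \<inter> A) \<union> (N a \<inter> D)) \<le> card (N a)"
      using x by (intro card_mono) auto
    ultimately show ?thesis by simp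
  qed
  then have "(\<Sum>a\<in>A. 1 + card (N a \<inter> A) + card (N a \<inter> D)) \<le> (\<Sum>a\<in>A. card (N a))"
    by (rule sum_mono)
  moreover have "(\<Sum>v\<in>V. card (N v)) = (\<Sum>v\<in>X. card (N v)) + (\<Sum>v\<in>A. card (N v))
      + (\<Sum>v\<in>D. card (N v)) + (\<Sum>v\<in>Q. card (N v))"
    unfolding V using disj fin by (simp add: sum.union_disjoint Int_Un_distrib2)
  ultimately show ?thesis
    using sum_card_N_Int_swap[OF fin(2,3)] by (simp add: sum.distrib sum_Suc)
qed

lemma card_partition:
  assumes V: "V = X \<union> A \<union> D \<union> Q"
    and disj: "X \<inter> A = {}" "X \<inter> D = {}" "X \<inter> Q = {}" "A \<inter> D = {}" "A \<inter> Q = {}" "D \<inter> Q = {}"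
  shows "card V = card X + card A + card D + card Q"
proof -
  have fin: "finite X" "finite A" "finite D" "finite Q" using V finite_V by auto
  show ?thesis unfolding V using disj fin by (simp add: card_Un_disjoint Int_Un_distrib2)
qed

text \<open>A walk of length three between two leaves must pass through both supports, and its
  middle edge joins them. If the leaves are adjacent, they support each other.\<close>

lemma leaf_supports_adjacent:
  assumes "N u = {a}" "N v = {b}" "p u \<noteq> p v"
  shows "b \<in> N a"
proof (cases "v \<in> N u")
  case True
  then show ?thesis using assms N_sym by auto
next
  case False
  have "u \<in> V" "v \<in> V" using assms N_in_V by blast+
  with False obtain a' b' where "a' \<in> N u" "b' \<in> N a'" "v \<in> N b'"
    using walk assms(3) by blast
  moreover from this have "a' = a" "b' = b" using assms N_sym[of v b'] by auto
  ultimately show ?thesis by simp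
qed

lemma sum_card_ge_card:
  assumes "finite D" "\<And>d. d \<in> D \<Longrightarrow> f d \<ge> (c::nat)"
  shows "sum f D \<ge> c * card D"
  using sum_bounded_below[of D c f] assms by (simp add: mult.commute)

text \<open>Degrees are positive, so only leaves fall short of 2, each by one.\<close>

lemma sum_ge_two_minus_leaves:
  assumes "D \<subseteq> V"
  shows "2 * card D \<le> (\<Sum>d\<in>D. card (N d)) + card {d\<in>D. card (N d) = 1}"
proof -
  have fin: "finite D" using assms finite_V finite_subset by blast
  have "(\<Sum>d\<in>D. 2) \<le> (\<Sum>d\<in>D. card (N d) + (if card (N d) = 1 then 1 else 0))"
    by (rule sum_mono) (use card_N_pos assms in force)
  then show ?thesis using fin by (simp add: sum.distrib sum.If_cases Int_def)
qed

text \<open>Supplies the third unit for each vertex of \<open>A\<close> in the degree count; only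
  vertices in the part of \<open>x\<close>, the instance of \<open>i\<close>, may lack it.\<close>

lemma sum_card_Int_ge:
  assumes "A \<subseteq> V" "\<And>a. a \<in> A \<Longrightarrow> p a \<noteq> i \<Longrightarrow> N a \<inter> A \<noteq> {}"
  shows "card A \<le> (\<Sum>a\<in>A. card (N a \<inter> A)) + card {a\<in>A. p a = i}"
proof -
  have fin: "finite A" using assms(1) finite_V finite_subset by blast
  have "(\<Sum>a\<in>A. 1) \<le> (\<Sum>a\<in>A. card (N a \<inter> A) + (if p a = i then 1 else 0))"
    by (rule sum_mono) (use assms(2) in \<open>auto simp: Suc_le_eq card_gt_0_iff\<close>)
  then show ?thesis using fin by (simp add: sum.distrib sum.If_cases Int_def)
qed

text \<open>Leaves in different parts have adjacent supports. As there is no \<open>K\<^sub>4\<close>, leaves occur in at most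
  three parts.\<close>

lemma sum_degree_leaf:
  assumes x: "N x = {y}"
  shows "3 * card V \<le> (\<Sum>v\<in>V. card (N v)) + 3 * n + 3"
proof -
  define A where "A = N y"
  define D where "D = (\<Union>a\<in>A. N a) - A - {y}"
  define Q where "Q = V - A - D - {y}"
  have xV: "x \<in> V" "y \<in> V" using x N_in_V by blast+
  have sub: "A \<subseteq> V" "D \<subseteq> V" "Q \<subseteq> V" using N_subset by (auto simp: A_def D_def Q_def)
  have fin: "finite A" "finite D" "finite Q" using sub finite_V finite_subset by blast+
  have V: "V = {y} \<union> A \<union> D \<union> Q" using sub xV by (auto simp: Q_def)
  have disj: "{y} \<inter> A = {}" "{y} \<inter> D = {}" "{y} \<inter> Q = {}" "A \<inter> D = {}" "A \<inter> Q = {}" "D \<inter> Q = {}"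
    by (auto simp: A_def D_def Q_def)
  \<comment> \<open>A walk from the leaf \<open>x\<close> starts with the edge to \<open>y\<close>,
    so its second inner vertex lies in \<open>A\<close>. The centre is \<open>{y}\<close>; the leaf
    \<open>x\<close> itself belongs to \<open>A\<close>.\<close>
  have reach: "N v \<inter> A \<noteq> {}" if v: "v \<in> V" "p v \<noteq> p x" "v \<noteq> y" for v
  proof -
    obtain a b where "a \<in> N x" "b \<in> N a" "v \<in> N b"
      using walk[OF xV(1) v(1)] v x by fastforce
    then show ?thesis using N_sym x by (auto simp: A_def)
  qed
  have S: "card A + card A + (\<Sum>a\<in>A. card (N a \<inter> A)) + (\<Sum>d\<in>D. card (N d \<inter> A))
    + (\<Sum>d\<in>D. card (N d)) + (\<Sum>q\<in>Q. card (N q)) \<le> (\<Sum>v\<in>V. card (N v))"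
    using sum_degree_ge[OF V disj] N_sym by (force simp: A_def)
  have A: "card A \<le> (\<Sum>a\<in>A. card (N a \<inter> A)) + card {a\<in>A. p a = p x}"
    by (rule sum_card_Int_ge[OF sub(1)]) (use reach sub disj in auto)
  have DA: "card D \<le> (\<Sum>d\<in>D. card (N d \<inter> A))"
  proof -
    have "N d \<inter> A \<noteq> {}" if "d \<in> D" for d using that N_sym by (auto simp: D_def)
    then show ?thesis
      using sum_card_ge_card[OF fin(2), of 1 "\<lambda>d. card (N d \<inter> A)"] fin
      by (simp add: Suc_le_eq card_gt_0_iff)
  qed
  have Qp: "p q = p x" if "q \<in> Q" for q
  proof (rule ccontr)
    assume "p q \<noteq> p x"
    then have "N q \<inter> A \<noteq> {}" using reach that sub by (auto simp: Q_def)
    then have "q \<in> A \<union> D \<union> {y}" using N_sym by (auto simp: D_def)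
    then show False using that by (auto simp: Q_def)
  qed
  define D1 where "D1 = {d\<in>D. card (N d) = 1}"
  define Q1 where "Q1 = {q\<in>Q. card (N q) = 1}"
  \<comment> \<open>Leaves of \<open>D\<close> in the part of \<open>x\<close> are charged to that
    part together with \<open>Q\<close>; \<open>L\<close> collects the others.\<close>
  define L where "L = {d\<in>D1. p d \<noteq> p x}"
  have px: "card {a\<in>A. p a = p x} + card {d\<in>D1. p d = p x} + card Q \<le> n"
  proof -
    have "card ({a\<in>A. p a = p x} \<union> {d\<in>D1. p d = p x} \<union> Q) \<le> n"
      by (rule card_le_one_part) (use sub Qp in \<open>auto simp: D1_def\<close>)
    moreover have "card ({a\<in>A. p a = p x} \<union> {d\<in>D1. p d = p x} \<union> Q) =
        card {a\<in>A. p a = p x} + card {d\<in>D1. p d = p x} + card Q"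
      using fin disj by (subst card_Un_disjoint; (subst card_Un_disjoint)?; auto simp: D1_def)
    ultimately show ?thesis by simp
  qed
  have D1: "card D1 = card {d\<in>D1. p d = p x} + card L"
  proof -
    have "D1 = {d\<in>D1. p d = p x} \<union> L" by (auto simp: L_def)
    moreover have "finite D1" using fin by (simp add: D1_def)
    ultimately show ?thesis by (metis (no_types, lifting) L_def card_Un_disjoint
      disjoint_iff finite_Un mem_Collect_eq)
  qed
  have supp: "\<exists>b. N z = {b} \<and> b \<in> N y" if "z \<in> L" for z
  proof -
    have "card (N z) = 1" using that by (simp add: L_def D1_def)
    then obtain b where "N z = {b}" by (rule card_1_singletonE)
    then show ?thesis using leaf_supports_adjacent[OF x, of z b] that by (auto simp: L_def)
  qed
  \<comment> \<open>If \<open>Q\<close> has no leaf, three parts in \<open>L\<close> would give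
    three mutually adjacent supports in \<open>N y\<close>, a \<open>K\<^sub>4\<close> with
    \<open>y\<close>. If \<open>Q\<close> has a leaf with support \<open>r\<close>, the supports of
    \<open>L\<close> are common neighbours of \<open>y\<close> and \<open>r\<close>, so there is
    only one, and \<open>L\<close> lies in one part.\<close>
  have LQ: "card L + card Q1 \<le> 2 * n"
  proof (cases "Q1 = {}")
    case True
    have L2: "card (p ` L) \<le> 2"
    proof (rule ccontr)
      assume "\<not> ?thesis"
      then have "3 \<le> card (p ` L)" by simp
      then obtain T where T: "T \<subseteq> p ` L" "card T = 3" by (meson obtain_subset_with_card_n)
      obtain i j k where ijk: "T = {i, j, k}" "i \<noteq> j" "j \<noteq> k" "i \<noteq> k"
        using T(2) by (metis card_3_iff)
      then have "i \<in> p ` L" "j \<in> p ` L" "k \<in> p ` L" using T(1) by auto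
      then obtain z1 z2 z3 where z: "z1 \<in> L" "z2 \<in> L" "z3 \<in> L" "p z1 \<noteq> p z2" "p z2 \<noteq> p z3" "p z1 \<noteq> p z3"
        using ijk by blast
      obtain b1 b2 b3 where b: "N z1 = {b1}" "N z2 = {b2}" "N z3 = {b3}"
          "b1 \<in> N y" "b2 \<in> N y" "b3 \<in> N y"
        using supp z(1-3) by metis
      have "b2 \<in> N b1" "b3 \<in> N b2" "b3 \<in> N b1"
        using leaf_supports_adjacent[OF b(1,2)] leaf_supports_adjacent[OF b(2,3)]
          leaf_supports_adjacent[OF b(1,3)] z by auto
      moreover have "y \<noteq> b2" using b(5) by auto
      ultimately have "b1 = b3" using C4_free[of b1 y b2 b3] b N_sym by blast
      then show False using \<open>b3 \<in> N b1\<close> by simp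
    qed
    then show ?thesis using card_le_parts[OF _ L2] True sub by (auto simp: L_def D1_def)
  next
    case False
    then obtain q where "q \<in> Q" "card (N q) = 1" by (auto simp: Q1_def)
    then obtain r where q: "q \<in> Q" "N q = {r}" by (metis card_1_singletonE)
    have ry: "r \<noteq> y" using q N_sym[of y q] by (auto simp: Q_def A_def)
    have "p z1 = p z2" if z: "z1 \<in> L" "z2 \<in> L" for z1 z2
    proof (rule ccontr)
      assume ne: "p z1 \<noteq> p z2"
      obtain b1 b2 where b: "N z1 = {b1}" "N z2 = {b2}" "b1 \<in> N y" "b2 \<in> N y"
        using supp z by metis
      have "b1 \<in> N r" "b2 \<in> N r"
        using leaf_supports_adjacent[OF q(2) b(1)] leaf_supports_adjacent[OF q(2) b(2)]
          Qp[OF q(1)] z by (auto simp: L_def)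
      then have "b1 = b2" using C4_free[of b1 y r b2] b ry by metis
      then show False using leaf_supports_adjacent[OF b(1,2) ne] by simp
    qed
    then have "card L \<le> n" by (intro card_le_one_part) (use sub in \<open>auto simp: L_def D1_def\<close>)
    moreover have "card Q1 \<le> n" by (intro card_le_one_part) (use sub Qp in \<open>auto simp: Q1_def\<close>)
    ultimately show ?thesis by simp
  qed
  have "2 * card D \<le> (\<Sum>d\<in>D. card (N d)) + card D1" "2 * card Q \<le> (\<Sum>d\<in>Q. card (N d)) + card Q1"
    using sum_ge_two_minus_leaves sub by (simp_all add: D1_def Q1_def)
  \<comment> \<open>Against three per vertex the loss is 3 for \<open>y\<close>, at most
    \<open>n\<close> by \<open>px\<close>, and at most \<open>2 * n\<close> by
    \<open>LQ\<close>.\<close>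
  then show ?thesis
    using S A DA px D1 LQ card_partition[OF V disj] by simp
qed

text \<open>Without leaves, only vertices in the part of \<open>x\<close> cause loss outside
  \<open>X\<close>: those of \<open>A\<close> without a neighbour in \<open>A\<close>, and those of
  \<open>Q\<close>. As \<open>x\<close> is in that part too, the total loss is at most
  \<open>n + 4\<close>, which suffices because \<open>n \<ge> 1\<close>.\<close>

lemma sum_degree_two_nonadjacent:
  assumes deg: "\<And>v. v \<in> V \<Longrightarrow> card (N v) \<ge> 2"
    and x: "N x = {y, z}" and yz: "y \<noteq> z" "z \<notin> N y"
  shows "3 * card V \<le> (\<Sum>v\<in>V. card (N v)) + 3 * n + 3"
proof -
  define X where "X = {x, y, z}"
  define A where "A = N y \<union> N z - {x}"
  define D where "D = (\<Union>a\<in>A. N a) - A - X"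
  define Q where "Q = V - A - D - X"
  have xV: "x \<in> V" "y \<in> V" "z \<in> V" using x N_in_V[of y x] N_in_V[of z x] by auto
  have xyz: "x \<in> N y" "x \<in> N z" "x \<noteq> y" "x \<noteq> z" "y \<notin> N z"
    using x yz N_sym[of y x] N_sym[of z x] N_sym[of y z] not_in_N[of x] by auto
  have sub: "A \<subseteq> V" "D \<subseteq> V" "Q \<subseteq> V" using N_subset by (auto simp: A_def D_def Q_def)
  have fin: "finite A" "finite D" "finite Q" using sub finite_V finite_subset by blast+
  have V: "V = X \<union> A \<union> D \<union> Q" using sub xV by (auto simp: Q_def X_def)
  have disj: "X \<inter> A = {}" "X \<inter> D = {}" "X \<inter> Q = {}" "A \<inter> D = {}" "A \<inter> Q = {}" "D \<inter> Q = {}"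
    using xyz yz by (auto simp: A_def D_def Q_def X_def)
  have reach: "N v \<inter> A \<noteq> {}" if v: "v \<in> V" "p v \<noteq> p x" "v \<notin> X" for v
  proof -
    obtain a b where ab: "a \<in> N x" "b \<in> N a" "v \<in> N b"
      using walk[OF xV(1) v(1)] v x by (fastforce simp: X_def)
    then have "b \<noteq> x" using v x by (auto simp: X_def)
    then have "b \<in> A" using ab x by (auto simp: A_def)
    then show ?thesis using ab N_sym by blast
  qed
  have "\<exists>c\<in>X. c \<in> N a" if "a \<in> A" for a using that N_sym by (auto simp: A_def X_def)
  then have S: "(\<Sum>v\<in>X. card (N v)) + card A + (\<Sum>a\<in>A. card (N a \<inter> A)) + (\<Sum>d\<in>D. card (N d \<inter> A))
    + (\<Sum>d\<in>D. card (N d)) + (\<Sum>q\<in>Q. card (N q)) \<le> (\<Sum>v\<in>V. card (N v))"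
    by (rule sum_degree_ge[OF V disj])
  \<comment> \<open>Only \<open>x\<close> is shared, so the degrees of \<open>y\<close> and
    \<open>z\<close> add up to \<open>card A + 2\<close>; \<open>x\<close> contributes 2
    more.\<close>
  have "N y \<inter> N z = {x}" using C4_free[of _ y z x] xyz yz by blast
  then have "card (N y) + card (N z) = card (N y \<union> N z) + 1" using card_Un_Int[of "N y" "N z"] by simp
  also have "card (N y \<union> N z) = card A + 1"
    using card_Suc_Diff1[of "N y \<union> N z" x] xyz by (simp add: A_def)
  finally have SX: "(\<Sum>v\<in>X. card (N v)) = card A + 4" using x xyz yz by (simp add: X_def)
  have A: "card A \<le> (\<Sum>a\<in>A. card (N a \<inter> A)) + card {a\<in>A. p a = p x}"
    by (rule sum_card_Int_ge[OF sub(1)]) (use reach sub disj in blast)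
  have DA: "1 * card D \<le> (\<Sum>d\<in>D. card (N d \<inter> A))"
  proof (rule sum_card_ge_card[OF fin(2)])
    fix d assume "d \<in> D"
    then have "N d \<inter> A \<noteq> {}" using N_sym by (auto simp: D_def)
    then show "1 \<le> card (N d \<inter> A)" by (simp add: Suc_le_eq card_gt_0_iff)
  qed
  have DD: "2 * card D \<le> (\<Sum>d\<in>D. card (N d))" "2 * card Q \<le> (\<Sum>d\<in>Q. card (N d))"
    using sub deg fin by (auto intro!: sum_card_ge_card)
  have Qp: "p q = p x" if "q \<in> Q" for q
  proof (rule ccontr)
    assume "p q \<noteq> p x"
    then have "N q \<inter> A \<noteq> {}" using reach that sub by (auto simp: Q_def)
    then have "q \<in> A \<union> D \<union> X" using N_sym by (auto simp: D_def)
    then show False using that by (auto simp: Q_def)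
  qed
  have px: "1 + card {a\<in>A. p a = p x} + card Q \<le> n"
  proof -
    have "card ({x} \<union> {a\<in>A. p a = p x} \<union> Q) \<le> n"
      by (rule card_le_one_part) (use sub xV Qp in auto)
    moreover have "{x} \<inter> {a\<in>A. p a = p x} = {}" "({x} \<union> {a\<in>A. p a = p x}) \<inter> Q = {}"
      using disj by (auto simp: X_def)
    ultimately show ?thesis using fin by (simp add: card_Un_disjoint)
  qed
  have "card X = 3" using xyz yz by (simp add: X_def)
  then show ?thesis using S SX A DA DD px card_partition[OF V disj] by simp
qed

text \<open>An unmatched \<open>a \<in> A\<close> outside the part of \<open>x\<close> is paid for by a neighbour in \<open>D\<close> of degree at
  least 3. If all its neighbours in \<open>D\<close> have degree 2 (the set \<open>B\<close>), they form pendant triangles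
  at \<open>a\<close>, which leave no walk of length three between two such vertices on the same side; hence
  \<open>B\<close> meets each of \<open>N y\<close> and \<open>N z\<close> in a single part.\<close>

lemma sum_degree_two_triangle:
  assumes deg: "\<And>v. v \<in> V \<Longrightarrow> card (N v) \<ge> 2"
    and tri: "\<And>v a b. \<lbrakk>card (N v) = 2; a \<in> N v; b \<in> N v; a \<noteq> b\<rbrakk> \<Longrightarrow> b \<in> N a"
    and x: "N x = {y, z}" and yz: "y \<noteq> z"
  shows "3 * card V \<le> (\<Sum>v\<in>V. card (N v)) + 3 * n + 3"
proof -
  define X where "X = {x, y, z}"
  define A where "A = N y \<union> N z - X"
  define D where "D = (\<Union>a\<in>A. N a) - A - X"
  define Q where "Q = V - A - D - X"
  have xV: "x \<in> V" "y \<in> V" "z \<in> V" using x N_in_V[of y x] N_in_V[of z x] by auto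
  have xyz: "x \<in> N y" "x \<in> N z" "x \<noteq> y" "x \<noteq> z"
    using x yz N_sym[of y x] N_sym[of z x] not_in_N[of x] by auto
  have adj: "z \<in> N y" "y \<in> N z" using tri[of x y z] tri[of x z y] x yz by auto
  have sub: "A \<subseteq> V" "D \<subseteq> V" "Q \<subseteq> V" using N_subset by (auto simp: A_def D_def Q_def)
  have fin: "finite A" "finite D" "finite Q" using sub finite_V finite_subset by blast+
  have V: "V = X \<union> A \<union> D \<union> Q" using sub xV by (auto simp: Q_def X_def)
  have disj: "X \<inter> A = {}" "X \<inter> D = {}" "X \<inter> Q = {}" "A \<inter> D = {}" "A \<inter> Q = {}" "D \<inter> Q = {}"
    by (auto simp: A_def D_def Q_def)
  have common: "N y \<inter> N z = {x}" using C4_free[of _ y z x] xyz yz by blast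
  have "\<exists>c\<in>X. c \<in> N a" if "a \<in> A" for a using that N_sym by (auto simp: A_def X_def)
  then have S: "(\<Sum>v\<in>X. card (N v)) + card A + (\<Sum>a\<in>A. card (N a \<inter> A)) + (\<Sum>d\<in>D. card (N d \<inter> A))
    + (\<Sum>d\<in>D. card (N d)) + (\<Sum>q\<in>Q. card (N q)) \<le> (\<Sum>v\<in>V. card (N v))"
    by (rule sum_degree_ge[OF V disj])
  \<comment> \<open>Here \<open>N y \<union> N z\<close> is all of \<open>X \<union> A\<close>,
    since \<open>y\<close> and \<open>z\<close> are adjacent; \<open>x\<close> is counted twice and
    has degree 2.\<close>
  have "card (N y) + card (N z) = card (N y \<union> N z) + 1" using card_Un_Int[of "N y" "N z"] common by simp
  also have "card (N y \<union> N z) = card (X \<union> A)"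
    by (rule arg_cong[where f = card]) (use adj xyz in \<open>auto simp: A_def X_def\<close>)
  also have "card (X \<union> A) = card A + 3" using disj fin xyz yz by (simp add: card_Un_disjoint X_def)
  finally have SX: "(\<Sum>v\<in>X. card (N v)) = card A + 6" using x xyz yz by (simp add: X_def)
  have Qp: "p q = p x" if q: "q \<in> Q" for q
  proof (rule ccontr)
    assume ne: "p q \<noteq> p x"
    have qV: "q \<in> V" "q \<notin> X" using q by (auto simp: Q_def)
    then obtain a b where ab: "a \<in> N x" "b \<in> N a" "q \<in> N b"
      using walk[OF xV(1), of q] ne x by (fastforce simp: X_def)
    have "b \<noteq> x" using ab(3) x qV by (auto simp: X_def)
    moreover have "b \<in> A \<union> X" using ab x by (auto simp: A_def)
    ultimately have "q \<in> A \<union> D \<union> X" using ab(3) by (auto simp: A_def D_def X_def)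
    then show False using q by (auto simp: Q_def)
  qed
  define U where "U = {a\<in>A. N a \<inter> A = {} \<and> p a \<noteq> p x}"
  define B where "B = {a\<in>U. \<forall>d\<in>N a \<inter> D. card (N d) = 2}"
  define D3 where "D3 = {d\<in>D. card (N d) \<ge> 3}"
  have finU: "finite U" "B \<subseteq> U" "finite D3" using fin by (auto simp: U_def B_def D3_def)
  have A: "card A \<le> (\<Sum>a\<in>A. card (N a \<inter> A)) + card {a\<in>A. p a = p x} + card U"
  proof -
    have "(\<Sum>a\<in>A. 1) \<le> (\<Sum>a\<in>A. card (N a \<inter> A) + (if p a = p x then 1 else 0) + (if a \<in> U then 1 else 0))"
    proof (rule sum_mono)
      fix a assume "a \<in> A"
      show "1 \<le> card (N a \<inter> A) + (if p a = p x then 1 else 0) + (if a \<in> U then 1 else 0)"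
      proof (cases "N a \<inter> A = {}")
        case True
        then show ?thesis using \<open>a \<in> A\<close> by (auto simp: U_def)
      next
        case False
        then have "card (N a \<inter> A) \<ge> 1" by (simp add: Suc_le_eq card_gt_0_iff)
        then show ?thesis by linarith
      qed
    qed
    moreover have "A \<inter> U = U" by (auto simp: U_def)
    ultimately show ?thesis using fin by (simp add: sum.distrib sum.If_cases Int_def)
  qed
  have "card (U - B) \<le> card (\<Union>d\<in>D3. N d \<inter> A)"
  proof (rule card_mono)
    show "U - B \<subseteq> (\<Union>d\<in>D3. N d \<inter> A)"
    proof
      fix a assume a: "a \<in> U - B"
      then obtain d where d: "d \<in> N a" "d \<in> D" "card (N d) \<noteq> 2" by (auto simp: B_def)
      moreover have "card (N d) \<ge> 2" using d sub deg by blast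
      ultimately have "d \<in> D3" by (simp add: D3_def)
      then show "a \<in> (\<Union>d\<in>D3. N d \<inter> A)" using a d N_sym by (auto simp: U_def)
    qed
  qed (use finU in auto)
  also have "\<dots> \<le> (\<Sum>d\<in>D3. card (N d \<inter> A))" by (rule card_UN_le[OF finU(3)])
  finally have good: "card (U - B) \<le> (\<Sum>d\<in>D3. card (N d \<inter> A))" .
  have UB: "card U = card (U - B) + card B"
    using card_Diff_subset[OF finite_subset[OF finU(2,1)] finU(2)] card_mono[OF finU(1,2)] by simp
  \<comment> \<open>A vertex of \<open>D\<close> has a neighbour in \<open>A\<close> and degree at
    least 2, which makes 3. From degree 3 on, the degree alone suffices, and all its edges into
    \<open>A\<close> are surplus that pays for \<open>U - B\<close>.\<close>
  have DD: "3 * card D + (\<Sum>d\<in>D3. card (N d \<inter> A)) \<le> (\<Sum>d\<in>D. card (N d \<inter> A)) + (\<Sum>d\<in>D. card (N d))"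
  proof -
    have "(\<Sum>d\<in>D. 3 + (if card (N d) \<ge> 3 then card (N d \<inter> A) else 0)) \<le> (\<Sum>d\<in>D. card (N d \<inter> A) + card (N d))"
    proof (rule sum_mono)
      fix d assume d: "d \<in> D"
      then have "N d \<inter> A \<noteq> {}" using N_sym by (auto simp: D_def)
      then have "card (N d \<inter> A) \<ge> 1" by (simp add: Suc_le_eq card_gt_0_iff)
      moreover have "card (N d) \<ge> 2" using d sub deg by blast
      ultimately show "3 + (if card (N d) \<ge> 3 then card (N d \<inter> A) else 0) \<le> card (N d \<inter> A) + card (N d)"
        by auto
    qed
    then show ?thesis using fin by (simp add: sum.distrib sum.If_cases Int_def D3_def mult.commute)
  qed
  have part: "p a = p a'" if c: "c \<in> {y, z}" and a: "a \<in> B" "a \<in> N c" and a': "a' \<in> B" "a' \<in> N c" for a a' c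
  proof (rule ccontr)
    assume ne: "p a \<noteq> p a'"
    \<comment> \<open>Only \<open>x\<close> is adjacent to both \<open>y\<close> and
      \<open>z\<close>, so \<open>c\<close> is the only neighbour of \<open>b\<close> in
      \<open>X\<close>; as \<open>b\<close> has none in \<open>A\<close>, the others lie in
      \<open>D\<close>.\<close>
    have nbr: "w = c \<or> w \<in> D" if w: "w \<in> N b" and b: "b \<in> B" "b \<in> N c" for w b
    proof -
      have bA: "b \<in> A" "N b \<inter> A = {}" using b by (auto simp: B_def U_def)
      have "b \<notin> N x" using bA x by (auto simp: A_def X_def)
      then have "w \<noteq> x" using N_sym w by blast
      moreover have "\<not> (b \<in> N y \<and> b \<in> N z)" using common bA by (auto simp: A_def X_def)
      then have "w = c" if "w \<in> {y, z}" using that c b w N_sym by blast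
      ultimately show ?thesis using bA w by (auto simp: D_def X_def)
    qed
    have aA: "a \<in> A" "N a \<inter> A = {}" "a' \<in> A" using a a' by (auto simp: B_def U_def)
    have notD: "w \<notin> D" if "w \<in> N c" for w using that c by (auto simp: D_def A_def)
    obtain s t where st: "s \<in> N a" "t \<in> N s" "a' \<in> N t"
      using walk[of a a'] aA sub ne by blast
    have t: "t = c \<or> t \<in> D" using nbr[of t a'] a' st N_sym by blast
    show False
    proof (cases "s = c")
      case True
      then show False using t st notD by auto
    next
      \<comment> \<open>Now \<open>s\<close> has degree 2, so its neighbours \<open>a\<close> and
        \<open>t\<close> are adjacent. Then \<open>t\<close> also lies in \<open>D\<close> and has
        degree 2, but it is adjacent to \<open>s\<close>, \<open>a\<close> and
        \<open>a'\<close>.\<close>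
      case False
      then have sD: "s \<in> D" using nbr[OF st(1) a] by blast
      then have s2: "card (N s) = 2" using a st by (auto simp: B_def)
      have "t \<noteq> a" using st(3) aA by blast
      then have ta: "t \<in> N a" using tri[OF s2, of a t] st N_sym by blast
      have "t \<noteq> c" using notD[of s] sD st N_sym by blast
      then have tD: "t \<in> D" using t by blast
      then have t2: "card (N t) = 2" using a ta by (auto simp: B_def)
      have "{s, a, a'} \<subseteq> N t" using st ta N_sym by blast
      moreover have "s \<noteq> a" "s \<noteq> a'" "a \<noteq> a'" using ne sD aA disj by blast+
      then have "card {s, a, a'} = 3" by simp
      ultimately show False using t2 card_mono[of "N t" "{s, a, a'}"] by simp
    qed
  qed
  have BN: "card (B \<inter> N c) \<le> n" if "c \<in> {y, z}" for c
    using part[OF that] sub by (intro card_le_one_part) (auto simp: B_def U_def)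
  have "B = (B \<inter> N y) \<union> (B \<inter> N z)" by (auto simp: B_def U_def A_def)
  then have "card B \<le> card (B \<inter> N y) + card (B \<inter> N z)" using card_Un_le by metis
  then have B: "card B \<le> 2 * n" using BN[of y] BN[of z] by simp
  have QQ: "2 * card Q \<le> (\<Sum>d\<in>Q. card (N d))"
    using sub deg fin by (auto intro!: sum_card_ge_card)
  have px: "card {a\<in>A. p a = p x} + card Q \<le> n"
  proof -
    have "card ({a\<in>A. p a = p x} \<union> Q) \<le> n"
      by (rule card_le_one_part) (use sub Qp in auto)
    moreover have "{a\<in>A. p a = p x} \<inter> Q = {}" using disj by auto
    ultimately show ?thesis using fin by (simp add: card_Un_disjoint)
  qed
  have "card X = 3" using xyz yz by (simp add: X_def)
  then show ?thesis using S SX A good UB DD B QQ px card_partition[OF V disj] by simp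
qed

text \<open>If all degrees are at least 3 nothing is lost. Otherwise there is a leaf, or a vertex of
  degree 2 with nonadjacent neighbours, or the neighbours of every vertex of degree 2 are
  adjacent.\<close>

lemma sum_degree_lower_bound: "3 * card V \<le> (\<Sum>v\<in>V. card (N v)) + 3 * n + 3"
proof (cases "\<exists>x\<in>V. card (N x) \<le> 2")
  case False
  then have "3 * card V \<le> (\<Sum>v\<in>V. card (N v))"
    by (intro sum_card_ge_card[OF finite_V]) force
  then show ?thesis by simp
next
  case two: True
  show ?thesis
  proof (cases "\<exists>x\<in>V. card (N x) = 1")
    case True
    then show ?thesis using sum_degree_leaf by (metis card_1_singletonE)
  next
    case False
    have deg: "card (N v) \<ge> 2" if "v \<in> V" for v
      using card_N_pos[OF that] False that by (metis Suc_1 le_antisym not_less_eq_eq One_nat_def)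
    then obtain x0 y0 z0 where x0: "N x0 = {y0, z0}" "y0 \<noteq> z0"
      using two by (metis card_2_iff le_antisym)
    show ?thesis
    proof (cases "\<exists>x y z. N x = {y, z} \<and> y \<noteq> z \<and> z \<notin> N y")
      case True
      then show ?thesis using sum_degree_two_nonadjacent deg by metis
    next
      case False
      have "b \<in> N a" if v: "card (N v) = 2" and ab: "a \<in> N v" "b \<in> N v" "a \<noteq> b" for v a b
      proof -
        have "N v = {a, b}"
          by (rule sym, rule card_seteq) (use v ab in auto)
        then show ?thesis using False ab(3) by blast
      qed
      then show ?thesis using sum_degree_two_triangle[OF deg _ x0] by blast
    qed
  qed
qed

end

section \<open>The upper bound\<close>

text \<open>Sort by \<open>p\<close> and match the first half with the second half in order: no class is long
  enough to contain two matched elements.\<close>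

lemma ex_matching_between_classes:
  fixes p :: "'a \<Rightarrow> 'b :: linorder"
  assumes R: "finite R" "even (card R)" and small: "\<And>i. 2 * card {v\<in>R. p v = i} \<le> card R"
  shows "\<exists>m. \<forall>v\<in>R. m v \<in> R \<and> m (m v) = v \<and> p (m v) \<noteq> p v"
proof -
  obtain h where h: "card R = 2 * h" using R(2) by blast
  obtain xs where xs: "set xs = R" "distinct xs" using finite_distinct_list[OF R(1)] by blast
  define ys where "ys = sort_key p xs"
  have ys: "set ys = R" "distinct ys" "sorted (map p ys)" by (simp_all add: ys_def xs)
  then have len: "length ys = 2 * h" using distinct_card h by metis
  have bij: "bij_betw ((!) ys) {..<2 * h} R" using bij_betw_nth[OF ys(2)] ys(1) len by simp
  have ne: "p (ys ! i) \<noteq> p (ys ! (i + h))" if i: "i < h" for i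
  proof
    assume eq: "p (ys ! i) = p (ys ! (i + h))"
    \<comment> \<open>If positions \<open>i\<close> and \<open>i + h\<close> carried the same class,
      sortedness would put all \<open>h + 1\<close> positions between them into it, while a class
      has at most \<open>h\<close> elements.\<close>
    have "(!) ys ` {i..i + h} \<subseteq> {v\<in>R. p v = p (ys ! i)}"
    proof (rule image_subsetI)
      fix j assume j: "j \<in> {i..i + h}"
      have "p (ys ! i) \<le> p (ys ! j)" "p (ys ! j) \<le> p (ys ! (i + h))"
        using sorted_nth_mono[OF ys(3), of i j] sorted_nth_mono[OF ys(3), of j "i + h"] j i len
        by auto
      then have "p (ys ! j) = p (ys ! i)" using eq by simp
      moreover have "ys ! j \<in> R" using ys(1) nth_mem[of j ys] j i len by auto
      ultimately show "ys ! j \<in> {v\<in>R. p v = p (ys ! i)}" by simp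
    qed
    then have "card ((!) ys ` {i..i + h}) \<le> card {v\<in>R. p v = p (ys ! i)}"
      by (rule card_mono[rotated]) (use R in simp)
    moreover have "inj_on ((!) ys) {i..i + h}"
      by (rule inj_on_subset[OF bij_betw_imp_inj_on[OF bij]]) (use i in auto)
    ultimately have "h + 1 \<le> card {v\<in>R. p v = p (ys ! i)}" by (simp add: card_image)
    then show False using small[of "p (ys ! i)"] h by simp
  qed
  define g where "g i = (if i < h then i + h else i - h)" for i
  define idx where "idx = inv_into {..<2 * h} ((!) ys)"
  have idx: "idx v < 2 * h" "ys ! idx v = v" if "v \<in> R" for v
    using that bij_betw_inv_into_right[OF bij that] bij_betw_apply[OF bij_betw_inv_into[OF bij] that]
    by (auto simp: idx_def)
  have idx': "idx (ys ! i) = i" if "i < 2 * h" for i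
    using bij_betw_inv_into_left[OF bij, of i] that by (simp add: idx_def)
  have g: "g i < 2 * h" "g (g i) = i" "p (ys ! g i) \<noteq> p (ys ! i)" if i: "i < 2 * h" for i
  proof -
    show "g i < 2 * h" "g (g i) = i" using i by (auto simp: g_def)
    show "p (ys ! g i) \<noteq> p (ys ! i)"
    proof (cases "i < h")
      case True
      then show ?thesis using ne[of i] by (simp add: g_def)
    next
      case False
      then have "i - h < h" "i - h + h = i" using i by simp_all
      then show ?thesis using ne[of "i - h"] False by (simp add: g_def)
    qed
  qed
  show ?thesis
  proof (intro exI[of _ "\<lambda>v. ys ! g (idx v)"] ballI)
    fix v assume v: "v \<in> R"
    have "ys ! g (idx v) \<in> R" using g(1)[OF idx(1)[OF v]] ys(1) len by (metis nth_mem)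
    then show "ys ! g (idx v) \<in> R \<and> ys ! g (idx (ys ! g (idx v))) = v \<and> p (ys ! g (idx v)) \<noteq> p v"
      using g[OF idx(1)[OF v]] idx(2)[OF v] by (simp add: idx')
  qed
qed

text \<open>A triangle on \<open>C\<close>, to whose vertices pendant triangles and leaves are attached: \<open>c v\<close> is the
  vertex of \<open>C\<close> to which \<open>v\<close> is attached, and \<open>m v\<close> is the third vertex of the pendant triangle
  containing \<open>v\<close>, or \<open>v\<close> itself if \<open>v\<close> is a leaf.\<close>

lemma ex_saturated_triangle_cactus:
  fixes V C :: "'a set" and p :: "'a \<Rightarrow> 'b" and c m :: "'a \<Rightarrow> 'a"
  defines "G \<equiv> (V, {{u, v} | u v. u \<in> V \<and> v \<in> V \<and> p u \<noteq> p v})"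
  assumes V: "finite V" and C: "C \<subseteq> V" "card C = 3" "inj_on p C"
    and c: "\<And>v. v \<in> V - C \<Longrightarrow> c v \<in> C \<and> p (c v) \<noteq> p v"
    and m: "\<And>v. v \<in> V - C \<Longrightarrow> m v \<in> V - C \<and> m (m v) = v \<and> c (m v) = c v \<and> (m v \<noteq> v \<longrightarrow> p (m v) \<noteq> p v)"
    and leaves: "\<And>v w. \<lbrakk>v \<in> V - C; w \<in> V - C; m v = v; m w = w; c v = c w\<rbrakk> \<Longrightarrow> p v = p w"
  shows "\<exists>E. saturated_in C4 G (V, E) \<and> 2 * card E + 3 + card {v\<in>V - C. m v = v} = 3 * card V"
proof -
  \<comment> \<open>The clauses are the central triangle, the edges to it in both directions, and
    the outer edges of the pendant triangles. The last clause is symmetric because \<open>m\<close>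
    is an involution.\<close>
  define adj where "adj u v \<longleftrightarrow> u \<in> C \<and> v \<in> C \<and> u \<noteq> v \<or> u \<in> V - C \<and> v = c u \<or> v \<in> V - C \<and> u = c v
      \<or> u \<in> V - C \<and> v = m u \<and> u \<noteq> v" for u v
  have adj_sym: "adj v u" if "adj u v" for u v
    using that m[of u] unfolding adj_def by auto
  have adj_out: "adj u v \<longleftrightarrow> v = c u \<or> v = m u \<and> u \<noteq> v" if "u \<in> V - C" for u v
    using that c[of v] unfolding adj_def by blast
  have adj_in: "adj u v \<longleftrightarrow> v \<in> C \<and> u \<noteq> v \<or> v \<in> V - C \<and> u = c v" if "u \<in> C" for u v
    using that m[of v] unfolding adj_def by blast
  define E where "E = {{u, v} | u v. adj u v}"
  have E_iff: "{u, v} \<in> E \<longleftrightarrow> adj u v" for u v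
    using adj_sym unfolding E_def by (auto simp: doubleton_eq_iff)
  have adj_p: "u \<in> V \<and> v \<in> V \<and> p u \<noteq> p v" if uv: "adj u v" for u v
  proof -
    consider "u \<in> C" "v \<in> C" "u \<noteq> v" | "u \<in> V - C" "v = c u" | "v \<in> V - C" "u = c v"
      | "u \<in> V - C" "v = m u" "u \<noteq> v"
      using uv unfolding adj_def by blast
    then show ?thesis
    proof cases
      case 1 then show ?thesis using C(1) inj_onD[OF C(3), of u v] by blast
    next
      case 2 then show ?thesis using C(1) c[of u] by auto
    next
      case 3 then show ?thesis using C(1) c[of v] by auto
    next
      case 4 then show ?thesis using m[of u] by auto
    qed
  qed
  have finC: "finite C" using C V finite_subset by blast
  have EG: "E \<subseteq> edges G" using adj_p by (auto simp: E_def G_def)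
  have G: "simple_graph G" using V by (auto simp: G_def simple_graph_def card_2_iff)
  have third: "\<exists>l\<in>C. l \<noteq> u \<and> l \<noteq> v" for u v
  proof (rule ccontr)
    assume "\<not> ?thesis"
    then have "C \<subseteq> {u, v}" by blast
    then have "card C \<le> card {u, v}" by (intro card_mono) auto
    also have "\<dots> \<le> 2" by (simp add: card_insert_if)
    finally show False using C(2) by simp
  qed
  have free: "b = d" if ab: "adj a b" and bx: "adj b x" and xd: "adj x d" and da: "adj d a" and ne: "a \<noteq> x"
    for a b x d
  proof (rule ccontr)
    assume bd: "b \<noteq> d"
    have nb: "adj a b" "adj a d" "adj x b" "adj x d" using that adj_sym by blast+
    \<comment> \<open>The two neighbours of \<open>x\<close> would have to be \<open>c x\<close> and
      \<open>m x\<close>. Adjacency of \<open>a\<close> to \<open>m x\<close> forces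
      \<open>a = c x\<close>, which is not adjacent to itself.\<close>
    have half: False if "a \<in> C" "x \<in> V - C" "adj a b" "adj a d" "adj x b" "adj x d" for a x
    proof -
      have "c x \<in> C" "m x \<in> V - C" "c (m x) = c x" using c m that(2) by blast+
      moreover have "adj a (c x)" "adj a (m x)" using that bd adj_out[OF that(2)] by metis+
      ultimately show False using adj_in[OF that(1)] by auto
    qed
    have "a \<in> V" "x \<in> V" using ab xd adj_p by blast+
    then consider "a \<in> C" "x \<in> C" | "a \<in> C" "x \<in> V - C" | "a \<in> V - C" "x \<in> C" | "a \<in> V - C" "x \<in> V - C"
      by blast
    then show False
    proof cases
      case 1
      then have bdC: "b \<in> C" "d \<in> C" "a \<noteq> b" "a \<noteq> d" "x \<noteq> b" "x \<noteq> d"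
        using nb adj_in ne by blast+
      then have "card {a, x, b, d} = 4" "{a, x, b, d} \<subseteq> C" using 1 ne bd by auto
      then show False using card_mono[OF finC, of "{a, x, b, d}"] C(2) by simp
    next
      case 2 then show False using half nb by blast
    next
      case 3 then show False using half[of x a] nb by blast
    next
      \<comment> \<open>Each of \<open>a\<close> and \<open>x\<close> has at most one neighbour
        outside \<open>C\<close>; two common neighbours force \<open>m a = m x\<close>, hence
        \<open>a = x\<close>.\<close>
      case 4
      have "c a \<in> C" "c x \<in> C" "m a \<in> V - C" "m x \<in> V - C" "m (m a) = a" "m (m x) = x"
        using c m 4 by blast+
      moreover have "m a = m x" using nb bd adj_out[OF 4(1)] adj_out[OF 4(2)] calculation by (metis DiffD2)
      ultimately show False using ne by metis
    qed
  qed
  have walk: "\<exists>a b. adj u a \<and> adj a b \<and> adj b v" if uv: "u \<in> V" "v \<in> V" "p u \<noteq> p v" "\<not> adj u v" for u v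
  proof -
    \<comment> \<open>The walk takes the long way around the central triangle to
      \<open>c v\<close>.\<close>
    have inout: "\<exists>l. adj u l \<and> adj l (c v) \<and> adj (c v) v" if "u \<in> C" "v \<in> V - C" "\<not> adj u v" for u v
    proof -
      obtain l where "l \<in> C" "l \<noteq> u" "l \<noteq> c v" using third by blast
      then show ?thesis using that c[of v] by (auto simp: adj_in)
    qed
    consider "u \<in> C" "v \<in> C" | "u \<in> C" "v \<in> V - C" | "u \<in> V - C" "v \<in> C" | "u \<in> V - C" "v \<in> V - C"
      using uv by blast
    then show ?thesis
    proof cases
      case 1 then show ?thesis using uv adj_in by blast
    next
      case 2 then show ?thesis using inout uv by blast
    next
      case 3 then show ?thesis using inout[of v u] uv adj_sym by blast
    next
      case 4
      have u: "adj u (c u)" "m u \<noteq> u \<Longrightarrow> adj u (m u) \<and> adj (m u) (c u)"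
        using adj_out[OF 4(1)] adj_out[of "m u"] m[OF 4(1)] by auto
      have v: "adj (c v) v" "m v \<noteq> v \<Longrightarrow> adj (c v) (m v) \<and> adj (m v) v"
        using adj_out[OF 4(2)] adj_out[of "m v"] m[OF 4(2)] adj_sym by auto
      \<comment> \<open>With different attachment vertices the walk uses a triangle edge. With the
        same one it detours through a pendant triangle, which exists because two leaves there would
        share a part.\<close>
      consider "c u \<noteq> c v" | "c u = c v" "m u \<noteq> u" | "c u = c v" "m v \<noteq> v"
        using leaves[OF 4] uv(3) by blast
      then show ?thesis
      proof cases
        case 1
        then have "adj (c u) (c v)" using c[OF 4(1)] c[OF 4(2)] adj_in by blast
        then show ?thesis using u v by blast
      next
        case 2 then show ?thesis using u(2) v(1) by metis
      next
        case 3 then show ?thesis using u(1) v(2) by metis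
      qed
    qed
  qed
  have "saturated_in C4 G (verts G, E)"
    unfolding saturated_in_C4_iff[OF G EG] E_iff
  proof (intro conjI allI impI)
    fix u v assume "{u, v} \<in> edges G - E"
    then have "u \<in> V \<and> v \<in> V \<and> p u \<noteq> p v \<and> \<not> adj u v"
      using E_iff by (auto simp: G_def doubleton_eq_iff)
    then show "\<exists>a b. adj u a \<and> adj a b \<and> adj b v" using walk by blast
  qed (use free in blast)
  moreover have "2 * card E + 3 + card {v\<in>V - C. m v = v} = 3 * card V"
  proof -
    \<comment> \<open>Outer vertices have degree 2, less one for leaves; the triangle has degree sum
      6 plus one per outer vertex. Altogether this is 3 per vertex, minus 3 and the number of
      leaves.\<close>
    have degC: "card {w. adj v w} = 2 + card {w\<in>V - C. c w = v}" if "v \<in> C" for v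
    proof -
      have "{w. adj v w} = (C - {v}) \<union> {w\<in>V - C. c w = v}" unfolding adj_in[OF that] by auto
      moreover have "card \<dots> = card (C - {v}) + card {w\<in>V - C. c w = v}"
        by (rule card_Un_disjoint) (use finC V in auto)
      ultimately show ?thesis using that C(2) finC by simp
    qed
    have deg: "card {w. adj v w} + (if m v = v then 1 else 0) = 2" if "v \<in> V - C" for v
    proof -
      have "{w. adj v w} = (if m v = v then {c v} else {c v, m v})" unfolding adj_out[OF that] by auto
      moreover have "c v \<noteq> m v" using c[OF that] m[OF that] by auto
      ultimately show ?thesis by simp
    qed
    have "(\<Sum>v\<in>V - C. card {w. adj v w} + (if m v = v then 1 else 0)) = (\<Sum>v\<in>V - C. 2)"
      by (rule sum.cong[OF refl deg])
    then have "(\<Sum>v\<in>V - C. card {w. adj v w}) + card {v\<in>V - C. m v = v} = 2 * card (V - C)"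
      using V by (simp add: sum.distrib sum.If_cases Int_def mult.commute)
    moreover have "(\<Sum>v\<in>C. card {w\<in>V - C. c w = v}) = card (V - C)"
    proof -
      have "(\<Sum>v\<in>C. \<Sum>w\<in>{w\<in>V - C. c w = v}. 1) = (\<Sum>w\<in>V - C. (1::nat))"
        by (rule sum.group) (use V finC c in auto)
      then show ?thesis by simp
    qed
    then have "(\<Sum>v\<in>C. card {w. adj v w}) = 6 + card (V - C)"
      using degC C(2) by (simp add: sum_Suc)
    moreover have "(\<Sum>v\<in>V. card {w. adj v w}) = (\<Sum>v\<in>V - C. card {w. adj v w}) + (\<Sum>v\<in>C. card {w. adj v w})"
      using sum.subset_diff[OF C(1) V] by simp
    moreover have "(\<Sum>v\<in>V. card {w. {v, w} \<in> E}) = 2 * card E"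
      by (rule simple_graph_sum_degree[OF V]) (use EG G in \<open>auto simp: simple_graph_def G_def\<close>)
    moreover have "card V = card (V - C) + 3" using card_Diff_subset[OF finC C(1)] card_mono[OF V C(1)] C(2) by simp
    ultimately show ?thesis by (simp add: E_iff)
  qed
  ultimately show ?thesis by (auto simp: G_def)
qed

text \<open>The central triangle takes one vertex from each of the parts 0, 1, 2. \<open>L\<close>
  will be the set of leaves, and the numerical conditions are those for matching all remaining
  vertices across parts.\<close>

lemma ex_saturated_multipartite:
  fixes k n s :: nat
  defines "V \<equiv> {..<k} \<times> {..<n}" and "C \<equiv> {(0, 0), (1, 0), (2, 0)}"
  defines "L \<equiv> {v\<in>V - C. s \<le> fst v \<and> fst v < s + 3}"
  assumes kn: "k \<ge> 3" "n \<ge> 1" and s: "s \<ge> 1"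
    and R: "even (card (V - C - L))" "\<And>i. 2 * card {v\<in>V - C - L. fst v = i} \<le> card (V - C - L)"
  shows "\<exists>H. saturated_in C4 (complete_multipartite k n) H \<and> 2 * card (edges H) + 3 + card L = 3 * k * n"
proof -
  have V: "finite V" by (simp add: V_def)
  obtain m where m: "\<forall>v\<in>V - C - L. m v \<in> V - C - L \<and> m (m v) = v \<and> fst (m v) \<noteq> fst v"
    using ex_matching_between_classes[OF _ R] V by auto
  define m' where "m' v = (if v \<in> L then v else m v)" for v
  \<comment> \<open>Two parts exclude at most two of the three triangle vertices. The choice is
    symmetric in \<open>v\<close> and \<open>m v\<close>, so matched vertices are attached to the
    same one.\<close>
  define a where "a v = (LEAST i. i \<noteq> fst v \<and> i \<noteq> fst (m v))" for v :: "nat \<times> nat"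
  have a: "a v < 3" "a v \<noteq> fst v" for v
  proof -
    have "\<exists>i\<in>{0, 1, 2}. i \<noteq> fst v \<and> i \<noteq> fst (m v)" by auto
    then obtain i where "i \<in> {0, 1, 2}" and i2: "i \<noteq> fst v \<and> i \<noteq> fst (m v)" by blast
    then have i: "i < 3" by auto
    show "a v \<noteq> fst v" unfolding a_def using LeastI[of "\<lambda>i. i \<noteq> fst v \<and> i \<noteq> fst (m v)", OF i2] by blast
    show "a v < 3" unfolding a_def by (rule le_less_trans[OF Least_le i]) (rule i2)
  qed
  \<comment> \<open>Leaves in part \<open>s + j\<close> go to the triangle vertex in part
    \<open>j\<close>; these parts differ because \<open>s \<ge> 1\<close>.\<close>
  define c where "c v = (if v \<in> L then fst v - s else a v, 0 :: nat)" for v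
  have C_iff: "(i, 0) \<in> C \<longleftrightarrow> i < 3" for i by (auto simp: C_def)
  have fixed: "x \<in> L" if "x \<in> V - C" "m' x = x" for x
    using that m unfolding m'_def by (metis DiffI)
  have CV: "C \<subseteq> V" "card C = 3" "inj_on fst C" using kn by (auto simp: C_def V_def)
  have sat: "\<exists>E. saturated_in C4 (V, {{u, v} | u v. u \<in> V \<and> v \<in> V \<and> fst u \<noteq> fst v}) (V, E) \<and>
      2 * card E + 3 + card {v\<in>V - C. m' v = v} = 3 * card V"
  proof (rule ex_saturated_triangle_cactus[OF V CV, of c m'])
    fix v assume v: "v \<in> V - C"
    show "c v \<in> C \<and> fst (c v) \<noteq> fst v"
      using a[of v] s by (auto simp: c_def C_iff L_def)
    show "m' v \<in> V - C \<and> m' (m' v) = v \<and> c (m' v) = c v \<and> (m' v \<noteq> v \<longrightarrow> fst (m' v) \<noteq> fst v)"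
    proof (cases "v \<in> L")
      case True
      then show ?thesis using v by (simp add: m'_def)
    next
      case False
      then have mv: "m v \<in> V - C - L" "m (m v) = v" "fst (m v) \<noteq> fst v" using v m by blast+
      then have "a (m v) = a v" unfolding a_def by (metis (no_types, lifting))
      then show ?thesis using v mv False by (simp add: m'_def c_def)
    qed
  next
    fix v w assume vw: "v \<in> V - C" "w \<in> V - C" "m' v = v" "m' w = w" "c v = c w"
    then have "v \<in> L" "w \<in> L" using fixed by blast+
    then show "fst v = fst w" using vw(5) by (auto simp: c_def L_def)
  qed
  have "L \<subseteq> V - C" by (auto simp: L_def)
  moreover have "m' v = v" if "v \<in> L" for v using that by (simp add: m'_def)
  ultimately have "{v\<in>V - C. m' v = v} = L" using fixed by blast
  moreover have "complete_multipartite k n = (V, {{u, v} | u v. u \<in> V \<and> v \<in> V \<and> fst u \<noteq> fst v})"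
    by (simp add: complete_multipartite_def V_def)
  ultimately show ?thesis using sat by (auto simp: V_def mult.assoc)
qed

section \<open>Bounds for complete multipartite graphs\<close>

lemma saturated_multipartite_lower_bound:
  assumes k: "k \<ge> 2" and n: "n \<ge> 1" and H: "saturated_in C4 (complete_multipartite k n) H"
  shows "3 * k * n \<le> 2 * card (edges H) + 3 * n + 3"
proof -
  let ?G = "complete_multipartite k n"
  define V where "V = {..<k} \<times> {..<n}"
  define E where "E = edges H"
  have G: "simple_graph ?G" by (rule simple_graph_complete_multipartite)
  have verts: "verts ?G = V" by (simp add: complete_multipartite_def V_def)
  have EG: "E \<subseteq> edges ?G" and "verts H = V"
    using H verts by (auto simp: saturated_in_def spanning_subgraph_def E_def)
  then have "H = (verts ?G, E)" using verts by (simp add: E_def prod_eq_iff)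
  then have sat: "saturated_in C4 ?G (verts ?G, E)" using H by simp
  note free = conjunct1[OF sat[unfolded saturated_in_C4_iff[OF G EG]], rule_format]
    and walk = conjunct2[OF sat[unfolded saturated_in_C4_iff[OF G EG]], rule_format]
  have edges: "{u, v} \<in> edges ?G \<longleftrightarrow> u \<in> V \<and> v \<in> V \<and> fst u \<noteq> fst v" for u v
  proof -
    have "edges ?G = {{u, v} | u v. u \<in> V \<and> v \<in> V \<and> fst u \<noteq> fst v}"
      by (simp add: complete_multipartite_def V_def)
    then show ?thesis by (auto simp: doubleton_eq_iff simp del: split_paired_Ex)
  qed
  interpret C4_saturated V "\<lambda>v. {w. {v, w} \<in> E}" fst n
  proof
    show "finite V" by (simp add: V_def)
    show "{w. {v, w} \<in> E} \<subseteq> V" for v using EG edges by blast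
    show "v \<in> {v. {w, v} \<in> E}" if "w \<in> {w. {v, w} \<in> E}" for v w using that by (simp add: insert_commute)
    show "fst w \<noteq> fst v" if "w \<in> {w. {v, w} \<in> E}" for v w using that EG edges[of v w] by auto
    show "b = d" if "b \<in> {w. {a, w} \<in> E}" "b \<in> {w. {c, w} \<in> E}" "d \<in> {w. {a, w} \<in> E}"
      "d \<in> {w. {c, w} \<in> E}" "a \<noteq> c" for a b c d
    proof -
      have "{a, b} \<in> E" "{b, c} \<in> E" "{c, d} \<in> E" "{d, a} \<in> E"
        using that by (simp_all add: insert_commute)
      then show ?thesis using free that(5) by blast
    qed
    show "\<exists>a b. a \<in> {w. {u, w} \<in> E} \<and> b \<in> {w. {a, w} \<in> E} \<and> v \<in> {w. {b, w} \<in> E}"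
      if "u \<in> V" "v \<in> V" "fst u \<noteq> fst v" "v \<notin> {w. {u, w} \<in> E}" for u v
    proof -
      have "{u, v} \<in> edges ?G - E" using that edges by simp
      then show ?thesis using walk by simp
    qed
    show "card {v\<in>V. fst v = i} \<le> n" for i
    proof -
      have "card {v\<in>V. fst v = i} \<le> card ({i} \<times> {..<n})" by (rule card_mono) (auto simp: V_def)
      then show ?thesis by simp
    qed
    show "\<exists>v\<in>V. fst v \<noteq> fst u" if "u \<in> V" for u
    proof (rule bexI)
      show "fst (if fst u = 0 then 1 else 0 :: nat, 0 :: nat) \<noteq> fst u" by simp
      show "(if fst u = 0 then 1 else 0, 0) \<in> V" using k n by (simp add: V_def)
    qed
  qed
  have "(\<Sum>v\<in>V. card {w. {v, w} \<in> E}) = 2 * card E"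
    by (rule simple_graph_sum_degree) (use EG G verts in \<open>auto simp: simple_graph_def V_def\<close>)
  then show ?thesis using sum_degree_lower_bound by (simp add: V_def E_def mult.assoc)
qed

lemma sat_attained:
  assumes "simple_graph G" "edges F \<noteq> {}"
  obtains H where "saturated_in F G H" "card (edges H) = sat G F"
  using LeastI_ex[of "\<lambda>m. \<exists>H. saturated_in F G H \<and> card (edges H) = m"] ex_saturated_in[OF assms]
  unfolding sat_def by blast

lemma sat_le: "saturated_in F G H \<Longrightarrow> sat G F \<le> card (edges H)"
  unfolding sat_def by (rule Least_le) blast

lemma sat_C4_lower_bound:
  assumes "k \<ge> 2" "n \<ge> 1"
  shows "3 * k * n \<le> 2 * sat (complete_multipartite k n) C4 + 3 * n + 3"
proof -
  have "edges C4 \<noteq> {}" by (simp add: C4_def)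
  then show ?thesis
    using sat_attained[OF simple_graph_complete_multipartite] saturated_multipartite_lower_bound[OF assms]
    by metis
qed

text \<open>With \<open>s = 2\<close> part \<open>2\<close> loses a vertex to the central triangle; with \<open>s = 3\<close> all vertices of
  three parts are leaves.\<close>

lemma sat_C4_upper_bound:
  fixes k n s :: nat
  assumes n: "n \<ge> 1" and k: "k \<ge> 4" and s: "s = 2 \<or> s = 3 \<and> k \<ge> 6"
    and l: "l = (if s = 3 then 3 * n else if k = 4 then 2 * n - 1 else 3 * n - 1)"
    and par: "even (k * n - 3 - l)" "k = 6 \<Longrightarrow> s = 2 \<Longrightarrow> n \<ge> 2"
  shows "2 * sat (complete_multipartite k n) C4 + 3 + l \<le> 3 * k * n"
proof -
  define V where "V = {..<k} \<times> {..<n}"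
  define C :: "(nat \<times> nat) set" where "C = {(0, 0), (1, 0), (2, 0)}"
  define L where "L = {v\<in>V - C. s \<le> fst v \<and> fst v < s + 3}"
  define R where "R = V - C - L"
  have fin: "finite V" "finite C" "finite L" by (auto simp: V_def C_def L_def)
  have CV: "C \<subseteq> V" using n k by (auto simp: C_def V_def)
  have "card L = l"
  proof (cases "s = 3")
    case True
    then have "L = {3, 4, 5} \<times> {..<n}" using s by (auto simp: L_def V_def C_def)
    then show ?thesis using l True by simp
  next
    case False
    then have s2: "s = 2" using s by simp
    \<comment> \<open>For \<open>k = 4\<close> only the two parts 2 and 3 remain for leaves.\<close>
    have "L = (if k = 4 then {2, 3} else {2, 3, 4}) \<times> {..<n} - {(2, 0)}"
      using k s2 by (auto simp: L_def V_def C_def)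
    then show ?thesis using l s2 n by (auto simp: card_Diff_subset)
  qed
  moreover have "card R = k * n - 3 - card L"
  proof -
    have "L \<subseteq> V - C" by (auto simp: L_def)
    then have "card R = card (V - C) - card L" unfolding R_def using fin by (simp add: card_Diff_subset)
    moreover have "card (V - C) = card V - 3" using card_Diff_subset[OF fin(2) CV] by (simp add: C_def)
    ultimately show ?thesis by (simp add: V_def)
  qed
  ultimately have cards: "card L = l" "card R = k * n - 3 - l" by simp_all
  have l3: "l \<le> 3 * n" using l by (auto split: if_splits)
  have small: "2 * card {v\<in>R. fst v = i} \<le> card R" for i
  proof -
    \<comment> \<open>Parts below \<open>s\<close> have lost a vertex to the triangle, the leaf
      parts and nonexistent parts contribute nothing, and parts from \<open>s + 3\<close> on are
      matched completely.\<close>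
    consider "i < s" | "s \<le> i" "i < s + 3 \<or> k \<le> i" | "s + 3 \<le> i" "i < k" by linarith
    then show ?thesis
    proof cases
      case 1
      have "card {v\<in>R. fst v = i} \<le> card ({i} \<times> {1..<n})"
        by (rule card_mono) (use 1 s in \<open>auto simp: R_def V_def C_def L_def\<close>)
      moreover have "2 * (n - 1) \<le> k * n - 3 - l"
      proof -
        consider "k = 4" | "k = 5" | "k \<ge> 6" using k by linarith
        then show ?thesis
        proof cases
          case 1 then show ?thesis using l s n by simp
        next
          case 2 then show ?thesis using l s n by simp
        next
          case 3
          then have "6 * n \<le> k * n" by simp
          then show ?thesis using l3 n by linarith
        qed
      qed
      ultimately show ?thesis using cards by simp
    next
      case 2
      then have "{v\<in>R. fst v = i} = {}" by (auto simp: R_def L_def V_def)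
      then show ?thesis by (simp only: card.empty)
    next
      case 3
      have "card {v\<in>R. fst v = i} \<le> card ({i} \<times> {..<n})"
        by (rule card_mono) (auto simp: R_def V_def)
      moreover have "2 * n \<le> k * n - 3 - l"
      proof -
        consider "k = 6" "s = 2" | "k = 7" | "k \<ge> 8" using 3 s by linarith
        then show ?thesis
        proof cases
          case 1 then show ?thesis using l par(2) by simp
        next
          case 2
          \<comment> \<open>For \<open>s = 3\<close> the number of vertices to be matched would be
            \<open>4 * n - 3\<close>; parity excludes this.\<close>
          have "odd (7 * n - 3 - 3 * n)" using n by presburger
          then have "s = 2" using 2 l s par(1) by auto
          then show ?thesis using 2 l n by simp
        next
          case 3
          then have "8 * n \<le> k * n" by simp
          then show ?thesis using l3 n by linarith
        qed
      qed
      ultimately show ?thesis using cards by simp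
    qed
  qed
  have "\<exists>H. saturated_in C4 (complete_multipartite k n) H \<and> 2 * card (edges H) + 3 + card L = 3 * k * n"
    unfolding L_def V_def C_def
    by (rule ex_saturated_multipartite)
      (use n k s par(1) cards(2) small in \<open>auto simp: R_def L_def V_def C_def\<close>)
  then show ?thesis using sat_le cards(1) by fastforce
qed

text \<open>For even \<open>k\<close> and odd \<open>n\<close> the construction with
  \<open>3 * n\<close> leaves meets the lower bound. Otherwise \<open>3 * n - 1\<close> leaves give
  a bound one above it in twice the number of edges, and parity rules out equality in the lower
  bound.\<close>

lemma sat_C4_eq:
  assumes k: "k \<ge> 5" and n: "n \<ge> 1"
  shows "2 * sat (complete_multipartite k n) C4 + 3 * n + (if even k \<and> odd n then 3 else 2) = 3 * k * n"
proof -
  have lower: "3 * k * n \<le> 2 * sat (complete_multipartite k n) C4 + 3 * n + 3"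
    using sat_C4_lower_bound[of k n] k n by simp
  have kn: "5 * n \<le> k * n" using k by simp
  show ?thesis
  proof (cases "even k \<and> odd n")
    case True
    then have k6: "k \<ge> 6" using k by (cases "k = 5") auto
    then have "6 * n \<le> k * n" by simp
    then have "2 * sat (complete_multipartite k n) C4 + 3 + 3 * n \<le> 3 * k * n"
      using True k6 n by (intro sat_C4_upper_bound[where s = 3]) auto
    then show ?thesis using lower True by simp
  next
    case False
    \<comment> \<open>The case \<open>k = 6\<close>, \<open>n = 1\<close> belongs to the other
      branch.\<close>
    have "k = 6 \<Longrightarrow> n \<ge> 2" using False n by (cases "n = 1") auto
    then have "2 * sat (complete_multipartite k n) C4 + 3 + (3 * n - 1) \<le> 3 * k * n"
      using False k n kn by (intro sat_C4_upper_bound[where s = 2]) auto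
    moreover have "even (3 * k * n + 3 * n)" using False by auto
    then have "2 * sat (complete_multipartite k n) C4 + 3 * n + 3 \<noteq> 3 * k * n" by presburger
    ultimately show ?thesis using lower False n by auto
  qed
qed

theorem theorem1p9:
  shows "(\<forall>k n :: nat. k \<ge> 5 \<and> n \<ge> 1 \<longrightarrow>
            int (sat (complete_multipartite k n) C4) = \<lfloor>(3 * (real k - 1) * real n - 2) / 2\<rfloor> \<and>
            real (sat (complete_multipartite k n) C4) =
              (if even k \<and> odd n then 3 / 2 * (real k - 1) * real n - 3 / 2
               else 3 / 2 * (real k - 1) * real n - 1)) \<and>
         (\<forall>n :: nat. n \<ge> 1 \<longrightarrow>
            \<lfloor>9 / 2 * real n - 1\<rfloor> \<le> int (sat (complete_multipartite 4 n) C4) \<and>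
            int (sat (complete_multipartite 4 n) C4) \<le> 5 * int n - 1)"
proof (intro conjI allI impI)
  fix k n :: nat assume kn: "k \<ge> 5 \<and> n \<ge> 1"
  have "real (2 * sat (complete_multipartite k n) C4 + 3 * n + (if even k \<and> odd n then 3 else 2)) = real (3 * k * n)"
    using sat_C4_eq kn by presburger
  then have *: "2 * real (sat (complete_multipartite k n) C4) + 3 * real n + (if even k \<and> odd n then 3 else 2) = 3 * real k * real n"
    by (simp split: if_splits)
  then show "real (sat (complete_multipartite k n) C4) =
      (if even k \<and> odd n then 3 / 2 * (real k - 1) * real n - 3 / 2
       else 3 / 2 * (real k - 1) * real n - 1)"
    by (auto simp: algebra_simps split: if_splits)
  show "int (sat (complete_multipartite k n) C4) = \<lfloor>(3 * (real k - 1) * real n - 2) / 2\<rfloor>"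
    by (rule sym, rule floor_unique) (use * in \<open>auto simp: algebra_simps split: if_splits\<close>)
next
  fix n :: nat assume n: "n \<ge> 1"
  have "real (3 * 4 * n) \<le> real (2 * sat (complete_multipartite 4 n) C4 + 3 * n + 3)"
    using sat_C4_lower_bound[of 4 n] n by linarith
  \<comment> \<open>The lower bound falls short of \<open>9 / 2 * real n - 1\<close> by only one
    half, which rounding down absorbs.\<close>
  then have "9 / 2 * real n - 1 < real (sat (complete_multipartite 4 n) C4) + 1" by simp
  then show "\<lfloor>9 / 2 * real n - 1\<rfloor> \<le> int (sat (complete_multipartite 4 n) C4)" by linarith
  have "2 * sat (complete_multipartite 4 n) C4 + 3 + (2 * n - 1) \<le> 3 * 4 * n"
    using n by (intro sat_C4_upper_bound[where s = 2]) auto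
  then show "int (sat (complete_multipartite 4 n) C4) \<le> 5 * int n - 1" using n by linarith
qed

end
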